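(* Let $k<N$ be positive integers, and for $p>0$ consider the equation $$\mathcal{P}^-_k(D^2u(x))+u^p(x)=0\quad\text{in }\mathbb{R}^N.\qquad ( * )$$ (1) For any $p>0$ there exist nonnegative viscosity solutions $u\not\equiv 0$ of $( * )$. (2) For any $p\ge 1$ there exist positive classical solutions of $( * )$. (3) For $0<p<1$ there are no positive viscosity supersolutions of $( * )$.
   Context: For a symmetric $N\times N$ real matrix $X$ with ordered eigenvalues $\lambda_1(X)\le\cdots\le\lambda_N(X)$, set $\mathcal{P}^-_k(X)=\sum_{i=1}^k\lambda_i(X)$. Viscosity notions for $F(D^2u)+u^p=0$ in an open set $\Omega$, with $F=\mathcal{P}^-_k$ and $u\ge 0$: $u$ is a viscosity supersolution if it is lower semicontinuous in $\Omega$ and, for every $x_0\in\Omega$ and every $C^2$ function $\varphi$ such that $u-\varphi$ has a local minimum at $x_0$, one has $F(D^2\varphi(x_0))+u(x_0)^p\le 0$; $u$ is a viscosity subsolution if it is upper semicontinuous in $\Omega$ and, whenever $u-\varphi$ has a local maximum at $x_0$, one has $F(D^2\varphi(x_0))+u(x_0)^p\ge 0$; $u$ is a viscosity solution if it is continuous and is both. A classical solution is a $C^2$ function satisfying the equation pointwise. "Positive" means $u>0$ everywhere. *)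

theory Defs
  imports "HOL-Analysis.Analysis" "HOL-Computational_Algebra.Polynomial"
begin

definition charpoly :: "real^'n^'n \<Rightarrow> real poly" where
  "charpoly X = det (mat [:0, 1:] - (\<chi> i j. [:X $ i $ j:]))"

text \<open>The real eigenvalues in nondecreasing order, repeated according to algebraic
  multiplicity. For symmetric \<open>X\<close> the list has length \<open>CARD('n)\<close>; the notion is
  only meant for such matrices.\<close>

definition eigenvalues_sorted :: "real^'n^'n \<Rightarrow> real list" where
  "eigenvalues_sorted X = sorted_list_of_multiset (proots (charpoly X))"

text \<open>Indices start at 1, as in \<open>\<lambda>\<^sub>1(X) \<le> \<dots> \<le> \<lambda>\<^sub>N(X)\<close>.\<close>

definition ordered_eigenvalue :: "nat \<Rightarrow> real^'n^'n \<Rightarrow> real" where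
  "ordered_eigenvalue i X = eigenvalues_sorted X ! (i - 1)"

definition P_minus :: "nat \<Rightarrow> real^'n^'n \<Rightarrow> real" where
  "P_minus k X = (\<Sum>i = 1..k. ordered_eigenvalue i X)"

definition gradient :: "(real^'n \<Rightarrow> real) \<Rightarrow> real^'n \<Rightarrow> real^'n" where
  "gradient u x = (\<chi> i. frechet_derivative u (at x) (axis i 1))"

definition hessian :: "(real^'n \<Rightarrow> real) \<Rightarrow> real^'n \<Rightarrow> real^'n^'n" where
  "hessian u x = jacobian (gradient u) (at x)"

text \<open>Derivatives are taken with respect to the full space, so from here on \<open>\<Omega>\<close> is
  meant to be open.\<close>

definition C2_on :: "(real^'n) set \<Rightarrow> (real^'n \<Rightarrow> real) \<Rightarrow> bool" where
  "C2_on \<Omega> u \<longleftrightarrow>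
    (\<forall>x\<in>\<Omega>. u differentiable (at x)) \<and>
    (\<forall>x\<in>\<Omega>. gradient u differentiable (at x)) \<and>
    continuous_on \<Omega> (hessian u)"

definition lower_semicontinuous_on :: "'a::topological_space set \<Rightarrow> ('a \<Rightarrow> real) \<Rightarrow> bool" where
  "lower_semicontinuous_on S u \<longleftrightarrow>
    (\<forall>x\<in>S. \<forall>a<u x. eventually (\<lambda>y. a < u y) (at x within S))"

definition upper_semicontinuous_on :: "'a::topological_space set \<Rightarrow> ('a \<Rightarrow> real) \<Rightarrow> bool" where
  "upper_semicontinuous_on S u \<longleftrightarrow>
    (\<forall>x\<in>S. \<forall>a>u x. eventually (\<lambda>y. u y < a) (at x within S))"

definition local_min_at :: "'a::topological_space set \<Rightarrow> ('a \<Rightarrow> real) \<Rightarrow> 'a \<Rightarrow> bool" where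
  "local_min_at S f x \<longleftrightarrow> eventually (\<lambda>y. f x \<le> f y) (at x within S)"

definition local_max_at :: "'a::topological_space set \<Rightarrow> ('a \<Rightarrow> real) \<Rightarrow> 'a \<Rightarrow> bool" where
  "local_max_at S f x \<longleftrightarrow> eventually (\<lambda>y. f y \<le> f x) (at x within S)"

text \<open>Solutions of \<open>F(D\<^sup>2u) + u\<^sup>p = 0\<close> in \<open>\<Omega>\<close>. All notions require \<open>u \<ge> 0\<close> in \<open>\<Omega>\<close>,
  so that \<open>u\<^sup>p\<close> makes sense; for \<open>p > 0\<close> one has \<open>0 powr p = 0\<close>.\<close>

definition viscosity_supersolution ::
  "(real^'n^'n \<Rightarrow> real) \<Rightarrow> real \<Rightarrow> (real^'n) set \<Rightarrow> (real^'n \<Rightarrow> real) \<Rightarrow> bool" where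
  "viscosity_supersolution F p \<Omega> u \<longleftrightarrow>
    (\<forall>x\<in>\<Omega>. 0 \<le> u x) \<and>
    lower_semicontinuous_on \<Omega> u \<and>
    (\<forall>x0\<in>\<Omega>. \<forall>\<phi>. C2_on \<Omega> \<phi> \<and> local_min_at \<Omega> (\<lambda>x. u x - \<phi> x) x0 \<longrightarrow>
      F (hessian \<phi> x0) + u x0 powr p \<le> 0)"

definition viscosity_subsolution ::
  "(real^'n^'n \<Rightarrow> real) \<Rightarrow> real \<Rightarrow> (real^'n) set \<Rightarrow> (real^'n \<Rightarrow> real) \<Rightarrow> bool" where
  "viscosity_subsolution F p \<Omega> u \<longleftrightarrow>
    (\<forall>x\<in>\<Omega>. 0 \<le> u x) \<and>
    upper_semicontinuous_on \<Omega> u \<and>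
    (\<forall>x0\<in>\<Omega>. \<forall>\<phi>. C2_on \<Omega> \<phi> \<and> local_max_at \<Omega> (\<lambda>x. u x - \<phi> x) x0 \<longrightarrow>
      F (hessian \<phi> x0) + u x0 powr p \<ge> 0)"

definition viscosity_solution ::
  "(real^'n^'n \<Rightarrow> real) \<Rightarrow> real \<Rightarrow> (real^'n) set \<Rightarrow> (real^'n \<Rightarrow> real) \<Rightarrow> bool" where
  "viscosity_solution F p \<Omega> u \<longleftrightarrow>
    continuous_on \<Omega> u \<and>
    viscosity_supersolution F p \<Omega> u \<and> viscosity_subsolution F p \<Omega> u"

definition classical_solution ::
  "(real^'n^'n \<Rightarrow> real) \<Rightarrow> real \<Rightarrow> (real^'n) set \<Rightarrow> (real^'n \<Rightarrow> real) \<Rightarrow> bool" where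
  "classical_solution F p \<Omega> u \<longleftrightarrow>
    (\<forall>x\<in>\<Omega>. 0 \<le> u x) \<and>
    C2_on \<Omega> u \<and>
    (\<forall>x\<in>\<Omega>. F (hessian u x) + u x powr p = 0)"

end

theory Submission
  imports Defs
begin

text \<open>The solutions are radial, \<open>u(x) = h(|x|\<^sup>2)\<close>, with a convex nonincreasing profile \<open>h\<close> satisfying
  \<open>2 k h' = - h\<^sup>p\<close>. Where \<open>h\<close> is twice differentiable, the Hessian \<open>2 h' I + 4 h'' x x\<^sup>T\<close> has the
  eigenvalue \<open>2 h'\<close> in the \<open>N - 1\<close> directions tangential to the sphere through \<open>x\<close>, and a radial eigenvalue
  that is at least as large. As \<open>k < N\<close>, the sum of the \<open>k\<close> smallest eigenvalues is \<open>2 k h' = - u\<^sup>p\<close>. For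
  \<open>p \<ge> 1\<close> the profile is positive on the whole half-line and the solution is classical; for \<open>p < 1\<close> it
  vanishes from some point on, and as it may fail to be of class \<open>C\<^sup>2\<close> at the edge of its support, the equation
  is verified in the viscosity sense (\<open>radial_viscosity_solution\<close>).

  Two extremal facts about \<open>P_minus k\<close> replace explicit computations of eigenvalues: a lower bound \<open>c\<close> for
  the quadratic form gives \<open>P_minus k X \<ge> k c\<close> (\<open>P_minus_ge\<close>), and an upper bound \<open>c\<close> on a single
  hyperplane gives \<open>P_minus k X \<le> k c\<close> (\<open>P_minus_le\<close>). Since \<open>P_minus\<close> is defined by roots of the
  characteristic polynomial, both rest on the spectral theorem for symmetric matrices and, for Hessians, on the
  symmetry of second derivatives. Combined with the second derivative test, they show that contact with a
  paraboloid \<open>a |x|\<^sup>2 + b\<close> bounds \<open>P_minus k\<close> of the Hessian by \<open>2 k a\<close> (\<open>P_minus_hessian_le\<close>,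
  \<open>P_minus_hessian_ge\<close>).

  The nonexistence for \<open>p < 1\<close> comes from sublinearity. On a ball of radius \<open>R\<close>, the largest multiple of
  the bump \<open>(R\<^sup>2 - |x|\<^sup>2)\<^sup>m\<close> below a positive supersolution touches it inside the ball, and for \<open>m\<close> large
  the equation at the contact point forces \<open>R\<^sup>2 \<le> C u(0)\<^sup>1\<^sup>-\<^sup>p\<close> with \<open>C\<close> independent of \<open>R\<close>, which is
  absurd for large \<open>R\<close> (\<open>no_positive_supersolution\<close>).\<close>

section \<open>The spectral theorem for symmetric matrices\<close>

text \<open>A maximum point of \<open>x \<bullet> f x\<close> on the unit sphere of \<open>S\<close> is an eigenvector. Working
  inside an invariant subspace allows the construction to be repeated on the orthogonal complement of
  the eigenvectors found so far.\<close>

lemma self_adjoint_eigenvector_in_subspace: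
  fixes f :: "'a::euclidean_space \<Rightarrow> 'a"
  assumes f: "linear f" and sym: "\<And>x y. f x \<bullet> y = x \<bullet> f y"
    and S: "subspace S" and inv: "f ` S \<subseteq> S" and ne: "dim S \<noteq> 0"
  obtains v where "v \<in> S" "norm v = 1" "f v = (v \<bullet> f v) *\<^sub>R v"
proof -
  interpret f: linear f by (rule f)
  let ?K = "sphere 0 1 \<inter> S"
  have "compact ?K"
    using closed_subspace[OF S] by (simp add: compact_Int_closed)
  moreover obtain w where w: "w \<in> S" "w \<noteq> 0"
    using ne by (metis dim_eq_0 singletonI subsetI)
  then have "w /\<^sub>R norm w \<in> ?K"
    by (simp add: S subspace_scale)
  then have "?K \<noteq> {}" by blast
  moreover have "continuous_on ?K (\<lambda>x. x \<bullet> f x)"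
    using f by (intro continuous_intros linear_continuous_on linear_conv_bounded_linear[THEN iffD1])
  ultimately obtain v where v: "v \<in> ?K" and vmax: "\<And>y. y \<in> ?K \<Longrightarrow> y \<bullet> f y \<le> v \<bullet> f v"
    using continuous_attains_sup[of ?K "\<lambda>x. x \<bullet> f x"] by blast
  define m where "m = v \<bullet> f v"
  define q where "q w = m * (w \<bullet> w) - w \<bullet> f w" for w
  have q_nonneg: "0 \<le> q w" if "w \<in> S" for w
  proof (cases "w = 0")
    case False
    have "w /\<^sub>R norm w \<in> ?K"
      using that False by (simp add: S subspace_scale)
    from vmax[OF this] have "(w \<bullet> f w) / (norm w)\<^sup>2 \<le> m"
      by (simp add: f.scaleR m_def power2_eq_square divide_simps mult_ac)
    then show ?thesis
      using False by (simp add: q_def divide_simps power2_norm_eq_inner split: if_splits)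
  qed (simp add: q_def f.zero)
  have vv: "v \<bullet> v = 1" "v \<in> S"
    using v by (auto simp: norm_eq_1)
  define w where "w = m *\<^sub>R v - f v"
  have wS: "w \<in> S"
    using vv inv by (auto simp: w_def intro!: S subspace_diff subspace_scale)
  \<comment> \<open>The first variation of \<open>q\<close> at its minimum point \<open>v\<close> vanishes in the direction \<open>w\<close>.\<close>
  have exp: "q (v - t *\<^sub>R w) = t * (t * q w - 2 * (w \<bullet> w))" for t
  proof -
    have fw: "v \<bullet> f w = w \<bullet> f v"
      using sym[of w v] sym[of v w] by (simp add: inner_commute)
    have "w \<bullet> w = m * (v \<bullet> w) - w \<bullet> f v"
      unfolding w_def by (simp add: inner_diff_left inner_diff_right inner_commute algebra_simps)
    moreover have "m * (v \<bullet> v) - v \<bullet> f v = 0"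
      by (simp add: vv m_def)
    ultimately show ?thesis
      unfolding q_def
      by (simp add: f.diff f.scaleR inner_diff_left inner_diff_right fw inner_commute[of w v])
        (simp add: algebra_simps)
  qed
  have ineq: "2 * (w \<bullet> w) \<le> t * q w" if "t > 0" for t
    using q_nonneg[of "v - t *\<^sub>R w"] that exp[of t]
    by (simp add: S subspace_diff subspace_scale vv(2) wS zero_le_mult_iff)
  have "w \<bullet> w \<le> 0"
  proof (rule ccontr)
    assume *: "\<not> w \<bullet> w \<le> 0"
    with ineq[of 1] have "q w > 0" by simp
    moreover from * have "w \<bullet> w > 0" by linarith
    ultimately show False
      using ineq[of "(w \<bullet> w) / q w"] by (simp del: inner_gt_zero_iff)
  qed
  then have "w = 0"
    by (metis inner_eq_zero_iff inner_ge_zero order_antisym)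
  then show thesis
    using that[of v] vv by (simp add: w_def m_def norm_eq_1)
qed

theorem self_adjoint_orthonormal_eigenbasis:
  fixes f :: "'a::euclidean_space \<Rightarrow> 'a"
  assumes f: "linear f" and sym: "\<And>x y. f x \<bullet> y = x \<bullet> f y"
  shows "\<lbrakk>subspace S; f ` S \<subseteq> S\<rbrakk> \<Longrightarrow> \<exists>B\<subseteq>S. finite B \<and> card B = dim S \<and> pairwise orthogonal B \<and>
    (\<forall>b\<in>B. norm b = 1 \<and> f b = (b \<bullet> f b) *\<^sub>R b)"
proof (induction "dim S" arbitrary: S)
  case 0
  then show ?case
    by (intro exI[of _ "{}"]) auto
next
  case (Suc n)
  obtain v where v: "v \<in> S" "norm v = 1" "f v = (v \<bullet> f v) *\<^sub>R v"
    using self_adjoint_eigenvector_in_subspace[OF f sym Suc.prems] Suc.hyps(2) by (metis nat.distinct(1))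
  define T where "T = {y \<in> S. \<forall>x \<in> span {v}. orthogonal x y}"
  have T_eq: "T = {y \<in> S. v \<bullet> y = 0}"
    by (auto simp: T_def orthogonal_def span_singleton)
  have "dim T + dim (span {v}) = dim S"
    unfolding T_def using v(1) Suc.prems
    by (intro dim_subspace_orthogonal_to_vectors) (auto simp: span_minimal)
  moreover have "dim (span {v}) = 1"
    using v by (simp add: dim_singleton) (metis norm_zero zero_neq_one)
  ultimately have dimT: "n = dim T" using Suc.hyps(2) by simp
  have T: "subspace T"
    using Suc.prems(1) by (auto simp: T_eq subspace_def inner_add_right)
  have "f ` T \<subseteq> T"
  proof clarify
    fix y assume y: "y \<in> T"
    have "v \<bullet> f y = (v \<bullet> f v) * (v \<bullet> y)"
      by (metis inner_scaleR_left sym v(3))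
    then show "f y \<in> T"
      using y Suc.prems by (auto simp: T_eq)
  qed
  from Suc.hyps(1)[OF dimT T this] obtain B where
    B: "B \<subseteq> T" "finite B" "card B = dim T" "pairwise orthogonal B"
      "\<forall>b\<in>B. norm b = 1 \<and> f b = (b \<bullet> f b) *\<^sub>R b" by blast
  have "v \<notin> B"
    using B(1) v(2) by (auto simp: T_eq norm_eq_1)
  moreover have "pairwise orthogonal (insert v B)"
    using B(1,4) by (auto simp: pairwise_insert T_eq orthogonal_def inner_commute)
  ultimately show ?case
    using B v dimT Suc.hyps(2) by (intro exI[of _ "insert v B"]) (auto simp: T_eq)
qed

text \<open>The eigenbasis is indexed by \<open>'n\<close> itself, so that it can serve as the columns of a matrix
  of the same type.\<close>

lemma symmetric_matrix_eigenbasis: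
  fixes X :: "real^'n^'n"
  assumes "transpose X = X"
  obtains e :: "'n \<Rightarrow> real^'n" and d :: "'n \<Rightarrow> real"
  where "\<And>i j. e i \<bullet> e j = (if i = j then 1 else 0)" "\<And>i. X *v e i = d i *\<^sub>R e i"
proof -
  have "(X *v x) \<bullet> y = x \<bullet> (X *v y)" for x y
    by (metis assms dot_lmul_matrix vector_transpose_matrix)
  from self_adjoint_orthonormal_eigenbasis[OF matrix_vector_mul_linear this, of UNIV]
  obtain B where B: "finite B" "card B = CARD('n)" "pairwise orthogonal B"
    "\<forall>b\<in>B. norm b = 1 \<and> X *v b = (b \<bullet> (X *v b)) *\<^sub>R b"
    by auto
  obtain e where e: "bij_betw e (UNIV :: 'n set) B"
    using B by (metis finite_same_card_bij finite_code)
  have eB: "e i \<in> B" for i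
    using e by (auto simp: bij_betw_def)
  have "e i \<bullet> e j = (if i = j then 1 else 0)" for i j
  proof (cases "i = j")
    case True
    then show ?thesis using B(4) eB by (simp add: norm_eq_1)
  next
    case False
    then have "e i \<noteq> e j" using e by (auto simp: bij_betw_def inj_on_def)
    then show ?thesis using False B(3) eB by (auto simp: pairwise_def orthogonal_def)
  qed
  then show thesis
    using that[of e "\<lambda>i. e i \<bullet> (X *v e i)"] B(4) eB by blast
qed

section \<open>The characteristic polynomial and sums of smallest eigenvalues\<close>

lemma constant_poly_matrix_mult:
  fixes A B :: "real^'n^'n"
  shows "(\<chi> i j. [:(A ** B) $ i $ j:]) = (\<chi> i j. [:A $ i $ j:]) ** (\<chi> i j. [:B $ i $ j:])"
proof -
  have "[:\<Sum>l\<in>UNIV. g l:] = (\<Sum>l\<in>UNIV. [:g l:])" for g :: "'n \<Rightarrow> real"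
    by (rule poly_eqI) (simp add: coeff_sum coeff_pCons split: nat.splits)
  then show ?thesis
    by (simp add: vec_eq_iff matrix_matrix_mult_def mult.commute)
qed

text \<open>With the eigenvectors as columns of \<open>Q\<close> one has \<open>X Q = Q D\<close> with \<open>D\<close> diagonal. This identity
  is transported to matrices with constant polynomial entries, where \<open>det (x - X) det Q = det Q det (x - D)\<close>,
  and \<open>det Q\<close> can be cancelled because \<open>Q\<close> is orthogonal.\<close>

lemma charpoly_eq_prod_eigenvalues:
  fixes X :: "real^'n^'n" and e :: "'n \<Rightarrow> real^'n" and d :: "'n \<Rightarrow> real"
  assumes e: "\<And>i j. e i \<bullet> e j = (if i = j then 1 else 0)" and d: "\<And>i. X *v e i = d i *\<^sub>R e i"
  shows "charpoly X = (\<Prod>i\<in>UNIV. [:- d i, 1:])"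
proof -
  define C :: "real^'n^'n \<Rightarrow> real poly^'n^'n" where "C A = (\<chi> i j. [:A $ i $ j:])" for A
  define Q :: "real^'n^'n" where "Q = (\<chi> i j. e j $ i)"
  define D :: "real^'n^'n" where "D = (\<chi> i j. if i = j then d i else 0)"
  define x :: "real poly^'n^'n" where "x = mat [:0, 1:]"
  have C_mult: "C (A ** B) = C A ** C B" for A B
    unfolding C_def by (rule constant_poly_matrix_mult)
  have "transpose Q ** Q = mat 1"
    using e by (auto simp: vec_eq_iff matrix_matrix_mult_def transpose_def Q_def mat_def inner_vec_def)
  then have "C (transpose Q) ** C Q = C (mat 1)" by (simp flip: C_mult)
  also have "C (mat 1) = mat 1"
    by (auto simp: C_def mat_def vec_eq_iff one_pCons)
  finally have "det (C (transpose Q)) * det (C Q) = 1"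
    by (metis det_I det_mul)
  then have nz: "det (C Q) \<noteq> 0" by auto
  have "X ** Q = Q ** D"
  proof -
    have "(X ** Q) $ i $ j = (X *v e j) $ i" for i j
      by (simp add: matrix_matrix_mult_def matrix_vector_mult_def Q_def)
    moreover have "(Q ** D) $ i $ j = (d j *\<^sub>R e j) $ i" for i j
      by (simp add: matrix_matrix_mult_def Q_def D_def if_distrib cong: if_cong)
    ultimately show ?thesis by (simp add: vec_eq_iff d)
  qed
  then have "C X ** C Q = C Q ** C D" by (simp flip: C_mult)
  moreover have "x ** C Q = C Q ** x"
    unfolding x_def by (simp add: vec_eq_iff matrix_matrix_mult_def mat_def if_distrib if_distribR
        mult.commute cong: if_cong)
  ultimately have "(x - C X) ** C Q = C Q ** (x - C D)"
    by (simp add: vec_eq_iff matrix_matrix_mult_def left_diff_distrib right_diff_distrib sum_subtractf)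
  then have "det (x - C X) * det (C Q) = det (C Q) * det (x - C D)"
    by (metis det_mul)
  then have "det (x - C X) = det (x - C D)" using nz by simp
  also have "\<dots> = (\<Prod>i\<in>UNIV. (x - C D) $ i $ i)"
    by (rule det_diagonal) (simp add: x_def C_def D_def mat_def)
  also have "\<dots> = (\<Prod>i\<in>UNIV. [:- d i, 1:])"
    by (simp add: x_def C_def D_def mat_def)
  finally show ?thesis by (simp add: charpoly_def x_def C_def)
qed

lemma eigenvalues_sorted_eq:
  fixes X :: "real^'n^'n"
  assumes e: "\<And>i j. e i \<bullet> e j = (if i = j then 1 else 0)" and d: "\<And>i::'n. X *v e i = d i *\<^sub>R e i"
  shows "mset (eigenvalues_sorted X) = image_mset d (mset_set UNIV)"
proof -
  have "proots (charpoly X) = (\<Sum>i\<in>UNIV. {#d i#})"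
    unfolding charpoly_eq_prod_eigenvalues[OF e d] by (subst proots_prod) auto
  then show ?thesis
    by (simp add: eigenvalues_sorted_def sum_unfold_sum_mset)
qed

lemma P_minus_ge:
  fixes X :: "real^'n^'n"
  assumes X: "transpose X = X" and k: "k \<le> CARD('n)" and c: "\<And>v. c * (v \<bullet> v) \<le> v \<bullet> (X *v v)"
  shows "real k * c \<le> P_minus k X"
proof -
  obtain e :: "'n \<Rightarrow> real^'n" and d :: "'n \<Rightarrow> real"
    where e: "\<And>i j. e i \<bullet> e j = (if i = j then 1 else 0)"
      and d: "\<And>i. X *v e i = d i *\<^sub>R e i"
    using symmetric_matrix_eigenbasis[OF X] by metis
  note m = eigenvalues_sorted_eq[OF e d]
  have len: "length (eigenvalues_sorted X) = CARD('n)"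
    using arg_cong[OF m, of size] by simp
  have "set (eigenvalues_sorted X) = range d"
    using arg_cong[OF m, of set_mset] by simp
  moreover have "c \<le> d i" for i
    using c[of "e i"] by (simp add: d e)
  ultimately have ge: "c \<le> y" if "y \<in> set (eigenvalues_sorted X)" for y
    using that by auto
  have "c \<le> ordered_eigenvalue i X" if "i \<in> {1..k}" for i
    unfolding ordered_eigenvalue_def using that k len by (intro ge nth_mem) auto
  then show ?thesis
    unfolding P_minus_def using sum_bounded_below[of "{1..k}" c "\<lambda>i. ordered_eigenvalue i X"] by simp
qed

text \<open>This is where \<open>k < N\<close> enters: a bound on the quadratic form that is known only on a hyperplane
  still controls all eigenvalues except the largest, hence the \<open>k\<close> smallest ones.\<close>

lemma P_minus_le:
  fixes X :: "real^'n^'n"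
  assumes X: "transpose X = X" and k: "k < CARD('n)"
    and c: "\<And>v. w \<bullet> v = 0 \<Longrightarrow> v \<bullet> (X *v v) \<le> c * (v \<bullet> v)"
  shows "P_minus k X \<le> real k * c"
proof -
  obtain e :: "'n \<Rightarrow> real^'n" and d :: "'n \<Rightarrow> real"
    where e: "\<And>i j. e i \<bullet> e j = (if i = j then 1 else 0)"
      and d: "\<And>i. X *v e i = d i *\<^sub>R e i"
    using symmetric_matrix_eigenbasis[OF X] by metis
  note m = eigenvalues_sorted_eq[OF e d]
  define L where "L = eigenvalues_sorted X"
  have len: "length L = CARD('n)"
    using arg_cong[OF m, of size] by (simp add: L_def)
  have sorted: "sorted L" by (simp add: L_def eigenvalues_sorted_def)
  \<comment> \<open>A plane spanned by two eigenvectors meets the hyperplane orthogonal to \<open>w\<close>.\<close>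
  have unique: "i = j" if "d i > c" "d j > c" for i j
  proof (rule ccontr)
    assume ij: "i \<noteq> j"
    obtain a b where ab: "w \<bullet> (a *\<^sub>R e i + b *\<^sub>R e j) = 0" "a \<noteq> 0 \<or> b \<noteq> 0"
    proof (cases "w \<bullet> e i = 0")
      case True
      then show ?thesis using that[of 1 0] by simp
    next
      case False
      then show ?thesis using that[of "- (w \<bullet> e j)" "w \<bullet> e i"] by (simp add: inner_diff_right)
    qed
    let ?v = "a *\<^sub>R e i + b *\<^sub>R e j"
    have "X *v ?v = (a * d i) *\<^sub>R e i + (b * d j) *\<^sub>R e j"
      by (simp add: matrix_vector_right_distrib d matrix_vector_mult_scaleR)
    then have "?v \<bullet> (X *v ?v) = d i * a\<^sup>2 + d j * b\<^sup>2"
      using ij by (simp add: inner_add_left inner_add_right e power2_eq_square)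
    moreover have "?v \<bullet> ?v = a\<^sup>2 + b\<^sup>2"
      using ij by (simp add: inner_add_left inner_add_right e power2_eq_square)
    ultimately have "d i * a\<^sup>2 + d j * b\<^sup>2 \<le> c * (a\<^sup>2 + b\<^sup>2)"
      using c[OF ab(1)] by simp
    then have "(d i - c) * a\<^sup>2 + (d j - c) * b\<^sup>2 \<le> 0" by (simp add: algebra_simps)
    moreover have "(d i - c) * a\<^sup>2 \<ge> 0" "(d j - c) * b\<^sup>2 \<ge> 0" using that by auto
    moreover have "(d i - c) * a\<^sup>2 > 0 \<or> (d j - c) * b\<^sup>2 > 0" using that ab(2) by auto
    ultimately show False by linarith
  qed
  have "card {i. d i > c} \<le> 1"
    using unique by (auto simp: card_le_Suc0_iff_eq)
  moreover have "size (filter_mset (\<lambda>y. y > c) (mset L)) = card {i. d i > c}"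
    by (simp add: L_def m filter_mset_image_mset)
  ultimately have count: "length (filter (\<lambda>y. y > c) L) \<le> 1"
    by (metis mset_filter size_mset)
  have le: "L ! j \<le> c" if j: "Suc j < CARD('n)" for j
  proof (rule ccontr)
    assume "\<not> L ! j \<le> c"
    moreover have "L ! j \<le> L ! Suc j"
      using sorted j len by (simp add: sorted_iff_nth_mono)
    ultimately have "{j, Suc j} \<subseteq> {l. l < length L \<and> L ! l > c}"
      using j len by auto
    from card_mono[OF _ this] have "2 \<le> length (filter (\<lambda>y. y > c) L)"
      by (simp add: length_filter_conv_card)
    with count show False by simp
  qed
  have "ordered_eigenvalue i X \<le> c" if "i \<in> {1..k}" for i
    unfolding ordered_eigenvalue_def L_def[symmetric] using that k by (intro le) auto
  then show ?thesis
    unfolding P_minus_def using sum_bounded_above[of "{1..k}" "\<lambda>i. ordered_eigenvalue i X" c] by simp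
qed

section \<open>Derivatives along lines and symmetry of the Hessian\<close>

lemma gradient_inner:
  fixes u :: "real^'n \<Rightarrow> real"
  assumes "u differentiable (at x)"
  shows "(u has_derivative (\<lambda>v. gradient u x \<bullet> v)) (at x)"
proof -
  let ?f = "frechet_derivative u (at x)"
  have D: "(u has_derivative ?f) (at x)"
    using assms frechet_derivative_works by blast
  then interpret f: linear ?f by (rule has_derivative_linear)
  have "?f v = gradient u x \<bullet> v" for v
  proof -
    have "?f v = ?f (\<Sum>i\<in>UNIV. v $ i *\<^sub>R axis i 1)"
      by (simp add: basis_expansion flip: scalar_mult_eq_scaleR)
    also have "\<dots> = gradient u x \<bullet> v"
      by (simp add: f.sum f.scaleR gradient_def inner_vec_def mult.commute)
    finally show ?thesis .
  qed
  then have "?f = (\<lambda>v. gradient u x \<bullet> v)" by (rule ext)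
  with D show ?thesis by simp
qed

lemma gradient_eqI:
  fixes u :: "real^'n \<Rightarrow> real"
  assumes "(u has_derivative (\<lambda>v. g \<bullet> v)) (at x)"
  shows "gradient u x = g"
proof -
  have "frechet_derivative u (at x) = (\<lambda>v. g \<bullet> v)"
    using frechet_derivative_at[OF assms] by (rule sym)
  then show ?thesis
    by (simp add: gradient_def vec_eq_iff inner_axis)
qed

lemma has_derivative_along_line:
  fixes F :: "'a::real_normed_vector \<Rightarrow> 'b::real_normed_vector"
  assumes "(F has_derivative F') (at (x + t *\<^sub>R v))"
  shows "((\<lambda>t. F (x + t *\<^sub>R v)) has_vector_derivative F' v) (at t)"
proof -
  have "((\<lambda>t. F (x + t *\<^sub>R v)) has_derivative (\<lambda>s. F' (s *\<^sub>R v))) (at t)"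
    by (rule has_derivative_compose[where g=F and f="\<lambda>t. x + t *\<^sub>R v", OF _ assms]) (auto intro!: derivative_eq_intros)
  moreover have "linear F'" by (rule has_derivative_linear[OF assms])
  ultimately show ?thesis by (simp add: has_vector_derivative_def linear_scale)
qed

lemma C2_derivatives_along_line:
  fixes \<phi> :: "real^'n \<Rightarrow> real"
  assumes "C2_on UNIV \<phi>"
  shows "((\<lambda>t. \<phi> (x + t *\<^sub>R v)) has_real_derivative gradient \<phi> (x + t *\<^sub>R v) \<bullet> v) (at t)"
    and "((\<lambda>t. gradient \<phi> (x + t *\<^sub>R v) \<bullet> w) has_real_derivative (hessian \<phi> (x + t *\<^sub>R v) *v v) \<bullet> w) (at t)"
proof -
  have "\<phi> differentiable (at y)" "gradient \<phi> differentiable (at y)" for y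
    using assms by (auto simp: C2_on_def)
  note d = gradient_inner[OF this(1)] this(2)[unfolded jacobian_works, folded hessian_def]
  show "((\<lambda>t. \<phi> (x + t *\<^sub>R v)) has_real_derivative gradient \<phi> (x + t *\<^sub>R v) \<bullet> v) (at t)"
    using has_derivative_along_line[OF d(1)] by (simp add: has_real_derivative_iff_has_vector_derivative)
  have "((\<lambda>t. gradient \<phi> (x + t *\<^sub>R v)) has_vector_derivative (hessian \<phi> (x + t *\<^sub>R v) *v v)) (at t)"
    using has_derivative_along_line[OF d(2)] by simp
  then show "((\<lambda>t. gradient \<phi> (x + t *\<^sub>R v) \<bullet> w) has_real_derivative (hessian \<phi> (x + t *\<^sub>R v) *v v) \<bullet> w) (at t)"
    unfolding has_real_derivative_iff_has_vector_derivative
    by (rule bounded_linear.has_vector_derivative[OF bounded_linear_inner_left])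
qed

text \<open>The mixed second difference of \<open>\<phi>\<close> over a parallelogram with sides \<open>s v\<close> and \<open>s w\<close>
  is controlled by two applications of the mean value theorem, first along \<open>v\<close> and then along \<open>w\<close>.\<close>

lemma mixed_second_difference:
  fixes \<phi> :: "real^'n \<Rightarrow> real"
  assumes C2: "C2_on UNIV \<phi>" and s: "0 < s"
  obtains y where "norm (y - x) \<le> s * (norm v + norm w)"
    and "\<phi> (x + s *\<^sub>R v + s *\<^sub>R w) - \<phi> (x + s *\<^sub>R v) - \<phi> (x + s *\<^sub>R w) + \<phi> x = s\<^sup>2 * ((hessian \<phi> y *v w) \<bullet> v)"
proof -
  let ?g = "\<lambda>t. \<phi> ((x + s *\<^sub>R w) + t *\<^sub>R v) - \<phi> (x + t *\<^sub>R v)"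
  have "(?g has_real_derivative
      gradient \<phi> ((x + s *\<^sub>R w) + t *\<^sub>R v) \<bullet> v - gradient \<phi> (x + t *\<^sub>R v) \<bullet> v) (at t)" for t
    by (intro DERIV_diff C2_derivatives_along_line[OF C2])
  from MVT2[OF s this] obtain t where t: "0 < t" "t < s" and
    1: "?g s - ?g 0 = s * (gradient \<phi> ((x + s *\<^sub>R w) + t *\<^sub>R v) \<bullet> v - gradient \<phi> (x + t *\<^sub>R v) \<bullet> v)"
    by auto
  let ?k = "\<lambda>r. gradient \<phi> ((x + t *\<^sub>R v) + r *\<^sub>R w) \<bullet> v"
  have "(?k has_real_derivative (hessian \<phi> ((x + t *\<^sub>R v) + r *\<^sub>R w) *v w) \<bullet> v) (at r)" for r
    by (intro C2_derivatives_along_line[OF C2])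
  from MVT2[OF s this] obtain r where r: "0 < r" "r < s" and
    2: "?k s - ?k 0 = s * ((hessian \<phi> ((x + t *\<^sub>R v) + r *\<^sub>R w) *v w) \<bullet> v)"
    by auto
  show thesis
  proof (rule that[of "x + t *\<^sub>R v + r *\<^sub>R w"])
    have "norm (t *\<^sub>R v + r *\<^sub>R w) \<le> t * norm v + r * norm w"
      using t r norm_triangle_ineq[of "t *\<^sub>R v" "r *\<^sub>R w"] by simp
    also have "\<dots> \<le> s * norm v + s * norm w"
      using t r by (intro add_mono mult_right_mono) auto
    finally show "norm (x + t *\<^sub>R v + r *\<^sub>R w - x) \<le> s * (norm v + norm w)"
      by (simp add: algebra_simps)
    show "\<phi> (x + s *\<^sub>R v + s *\<^sub>R w) - \<phi> (x + s *\<^sub>R v) - \<phi> (x + s *\<^sub>R w) + \<phi> x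
        = s\<^sup>2 * ((hessian \<phi> (x + t *\<^sub>R v + r *\<^sub>R w) *v w) \<bullet> v)"
      using 1 2 by (simp add: power2_eq_square add.assoc add.left_commute add.commute)
  qed
qed

text \<open>The second difference is symmetric in \<open>v\<close> and \<open>w\<close>; by continuity of the Hessian its quotient by
  \<open>s\<^sup>2\<close> converges to the second derivative, so the latter is symmetric too.\<close>

lemma hessian_symmetric:
  fixes \<phi> :: "real^'n \<Rightarrow> real"
  assumes C2: "C2_on UNIV \<phi>"
  shows "transpose (hessian \<phi> x) = hessian \<phi> x"
proof -
  have lim: "(\<lambda>n. (\<phi> (x + s n *\<^sub>R v + s n *\<^sub>R w) - \<phi> (x + s n *\<^sub>R v) - \<phi> (x + s n *\<^sub>R w) + \<phi> x) / (s n)\<^sup>2)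
      \<longlonglongrightarrow> (hessian \<phi> x *v w) \<bullet> v"
    if s: "s = (\<lambda>n. inverse (real (Suc n)))" for v w :: "real^'n" and s
  proof -
    have "\<exists>y. norm (y - x) \<le> s n * (norm v + norm w) \<and>
      \<phi> (x + s n *\<^sub>R v + s n *\<^sub>R w) - \<phi> (x + s n *\<^sub>R v) - \<phi> (x + s n *\<^sub>R w) + \<phi> x
        = (s n)\<^sup>2 * ((hessian \<phi> y *v w) \<bullet> v)" for n
      by (rule mixed_second_difference[OF C2, of "s n" x v w]) (auto simp: s)
    then obtain y where y: "\<And>n. norm (y n - x) \<le> s n * (norm v + norm w)"
      "\<And>n. \<phi> (x + s n *\<^sub>R v + s n *\<^sub>R w) - \<phi> (x + s n *\<^sub>R v) - \<phi> (x + s n *\<^sub>R w) + \<phi> x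
        = (s n)\<^sup>2 * ((hessian \<phi> (y n) *v w) \<bullet> v)" by metis
    have "(\<lambda>n. s n * (norm v + norm w)) \<longlonglongrightarrow> 0 * (norm v + norm w)"
      unfolding s by (intro tendsto_intros LIMSEQ_inverse_real_of_nat)
    then have "y \<longlonglongrightarrow> x"
      using y(1) by (intro LIM_zero_cancel[of y x] Lim_null_comparison[of "\<lambda>n. y n - x"]) auto
    moreover have "isCont (hessian \<phi>) x"
      using C2 by (simp add: C2_on_def continuous_on_eq_continuous_at)
    ultimately have "(\<lambda>n. hessian \<phi> (y n)) \<longlonglongrightarrow> hessian \<phi> x"
      by (rule isCont_tendsto_compose[rotated])
    then have "(\<lambda>n. hessian \<phi> (y n) *v w) \<longlonglongrightarrow> hessian \<phi> x *v w"
      unfolding matrix_vector_mult_def by (intro vec_tendstoI) (auto intro!: tendsto_intros)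
    then have "(\<lambda>n. (hessian \<phi> (y n) *v w) \<bullet> v) \<longlonglongrightarrow> (hessian \<phi> x *v w) \<bullet> v"
      by (intro tendsto_intros)
    moreover have "s n \<noteq> 0" for n by (simp add: s)
    ultimately show ?thesis by (simp add: y(2))
  qed
  have "(hessian \<phi> x *v w) \<bullet> v = (hessian \<phi> x *v v) \<bullet> w" for v w
    using LIMSEQ_unique[OF lim[OF refl, of v w]] lim[OF refl, of w v]
    by (simp add: add.commute add.left_commute diff_diff_eq)
  from this[of "axis _ 1" "axis _ 1"] show ?thesis
    by (simp add: vec_eq_iff transpose_def inner_axis matrix_vector_mult_basis column_def)
qed

section \<open>Contact with paraboloids\<close>

lemma second_derivative_nonpos_at_local_max:
  fixes f :: "real \<Rightarrow> real"
  assumes f: "\<And>t. (f has_real_derivative f' t) (at t)" and f': "(f' has_real_derivative D) (at a)"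
    and max: "eventually (\<lambda>t. f t \<le> f a) (at a)"
  shows "D \<le> 0"
proof (rule ccontr)
  assume "\<not> D \<le> 0"
  obtain \<delta> where \<delta>: "\<delta> > 0" "\<And>t. \<bar>a - t\<bar> < \<delta> \<Longrightarrow> f t \<le> f a"
  proof -
    obtain \<delta> where "\<delta> > 0" and \<delta>: "\<And>t. t \<noteq> a \<Longrightarrow> dist t a < \<delta> \<Longrightarrow> f t \<le> f a"
      using max unfolding eventually_at by auto
    have "f t \<le> f a" if "\<bar>a - t\<bar> < \<delta>" for t
      using that \<delta>[of t] by (cases "t = a") (auto simp: dist_real_def abs_minus_commute)
    with \<open>\<delta> > 0\<close> show thesis using that by blast
  qed
  then have "f' a = 0"
    using DERIV_local_max[OF f] by blast
  moreover obtain \<epsilon> where \<epsilon>: "\<epsilon> > 0" "\<And>h. h > 0 \<Longrightarrow> h < \<epsilon> \<Longrightarrow> f' a < f' (a + h)"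
    using DERIV_pos_inc_right[OF f'] \<open>\<not> D \<le> 0\<close> by auto
  define h where "h = min \<delta> \<epsilon> / 2"
  have h: "h > 0" "h < \<delta>" "h < \<epsilon>" using \<delta>(1) \<epsilon>(1) by (auto simp: h_def min_def)
  obtain z where z: "a < z" "z < a + h" "f (a + h) - f a = h * f' z"
    using MVT2[of a "a + h" f f'] f h(1) by auto
  have "f' z > 0"
    using \<epsilon>(2)[of "z - a"] z h \<open>f' a = 0\<close> by simp
  then have "f (a + h) > f a" using z(3) h(1) by (smt (verit) mult_pos_pos)
  with \<delta>(2)[of "a + h"] h show False by simp
qed

text \<open>The sign of \<open>\<sigma>\<close> decides whether the paraboloid touches \<open>\<phi>\<close> from above or from below. Contact is
  formulated along a line because radial functions give contact from above only in tangential directions.\<close>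

lemma hessian_paraboloid_touching:
  fixes \<phi> :: "real^'n \<Rightarrow> real"
  assumes C2: "C2_on UNIV \<phi>"
    and touch: "\<forall>\<^sub>F t in at 0. \<sigma> * (\<phi> (x + t *\<^sub>R v) - a * (norm (x + t *\<^sub>R v))\<^sup>2) \<le> \<sigma> * (\<phi> x - a * (norm x)\<^sup>2)"
  shows "\<sigma> * (v \<bullet> (hessian \<phi> x *v v) - 2 * a * (v \<bullet> v)) \<le> 0"
proof -
  have n: "(norm (x + t *\<^sub>R v))\<^sup>2 = (norm x)\<^sup>2 + 2 * t * (x \<bullet> v) + t\<^sup>2 * (v \<bullet> v)" for t
    unfolding power2_norm_eq_inner
    by (simp add: inner_add_left inner_add_right inner_commute power2_eq_square)
  let ?f = "\<lambda>t. \<sigma> * (\<phi> (x + t *\<^sub>R v) - a * ((norm x)\<^sup>2 + 2 * t * (x \<bullet> v) + t\<^sup>2 * (v \<bullet> v)))"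
  let ?f' = "\<lambda>t. \<sigma> * (gradient \<phi> (x + t *\<^sub>R v) \<bullet> v - a * (2 * (x \<bullet> v) + 2 * t * (v \<bullet> v)))"
  have "\<sigma> * ((hessian \<phi> (x + 0 *\<^sub>R v) *v v) \<bullet> v - a * (2 * (v \<bullet> v))) \<le> 0"
  proof (rule second_derivative_nonpos_at_local_max[of ?f ?f'])
    show "(?f has_real_derivative ?f' t) (at t)" for t
      by (auto intro!: derivative_eq_intros C2_derivatives_along_line[OF C2])
    show "(?f' has_real_derivative \<sigma> * ((hessian \<phi> (x + 0 *\<^sub>R v) *v v) \<bullet> v - a * (2 * (v \<bullet> v)))) (at 0)"
      by (auto intro!: derivative_eq_intros C2_derivatives_along_line[OF C2])
    show "\<forall>\<^sub>F t in at 0. ?f t \<le> ?f 0"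
      using touch by (simp add: n)
  qed
  then show ?thesis by (simp add: inner_commute mult_ac)
qed

lemma tendsto_along_line: "((\<lambda>t. x + t *\<^sub>R v) \<longlongrightarrow> x) (at (0::real))"
  for x v :: "'a::real_normed_vector"
proof -
  have "((\<lambda>t. x + t *\<^sub>R v) \<longlongrightarrow> x + 0 *\<^sub>R v) (at 0)"
    by (intro tendsto_intros)
  then show ?thesis by simp
qed

text \<open>The directions orthogonal to \<open>x\<close> are tangential to the sphere through \<open>x\<close> and fill a hyperplane
  unless \<open>x = 0\<close>, so that \<open>P_minus_le\<close> applies with \<open>w = x\<close>.\<close>

lemma P_minus_hessian_le:
  fixes \<phi> :: "real^'n \<Rightarrow> real"
  assumes C2: "C2_on UNIV \<phi>" and k: "k < CARD('n)"
    and touch: "\<And>v. x \<bullet> v = 0 \<Longrightarrow>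
      \<forall>\<^sub>F t in at 0. \<phi> (x + t *\<^sub>R v) - a * (norm (x + t *\<^sub>R v))\<^sup>2 \<le> \<phi> x - a * (norm x)\<^sup>2"
  shows "P_minus k (hessian \<phi> x) \<le> 2 * real k * a"
proof -
  have "v \<bullet> (hessian \<phi> x *v v) \<le> 2 * a * (v \<bullet> v)" if "x \<bullet> v = 0" for v
    using hessian_paraboloid_touching[OF C2, of 1 x v a] touch[OF that] by simp
  then have "P_minus k (hessian \<phi> x) \<le> real k * (2 * a)"
    using P_minus_le[OF hessian_symmetric[OF C2] k, of x x "2 * a"] by simp
  then show ?thesis by (simp add: mult_ac)
qed

lemma P_minus_hessian_ge:
  fixes \<phi> :: "real^'n \<Rightarrow> real"
  assumes C2: "C2_on UNIV \<phi>" and k: "k < CARD('n)"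
    and touch: "\<forall>\<^sub>F y in nhds x. \<phi> y - a * (norm y)\<^sup>2 \<ge> \<phi> x - a * (norm x)\<^sup>2"
  shows "P_minus k (hessian \<phi> x) \<ge> 2 * real k * a"
proof -
  have "2 * a * (v \<bullet> v) \<le> v \<bullet> (hessian \<phi> x *v v)" for v
  proof -
    have "\<forall>\<^sub>F t in at 0. \<phi> (x + t *\<^sub>R v) - a * (norm (x + t *\<^sub>R v))\<^sup>2 \<ge> \<phi> x - a * (norm x)\<^sup>2"
      using touch tendsto_along_line by (rule eventually_compose_filterlim)
    then have "\<forall>\<^sub>F t in at 0. - 1 * (\<phi> (x + t *\<^sub>R v) - a * (norm (x + t *\<^sub>R v))\<^sup>2) \<le> - 1 * (\<phi> x - a * (norm x)\<^sup>2)"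
      by eventually_elim simp
    then show ?thesis
      using hessian_paraboloid_touching[OF C2, of "-1" x v a] by simp
  qed
  then have "real k * (2 * a) \<le> P_minus k (hessian \<phi> x)"
    using P_minus_ge[OF hessian_symmetric[OF C2], of k "2 * a" x] k by simp
  then show ?thesis by (simp add: mult_ac)
qed

section \<open>Radial solutions\<close>

text \<open>The Hessian of \<open>h (|x|\<^sup>2)\<close> is \<open>2 h' I + 4 h'' x x\<^sup>T\<close>. Writing radial functions in terms of
  \<open>|x|\<^sup>2\<close> instead of \<open>|x|\<close> keeps them smooth at the origin.\<close>

lemma C2_radial:
  fixes h h' h'' :: "real \<Rightarrow> real"
  assumes h: "\<And>s. 0 \<le> s \<Longrightarrow> (h has_real_derivative h' s) (at s)"
    and h': "\<And>s. 0 \<le> s \<Longrightarrow> (h' has_real_derivative h'' s) (at s)"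
    and h'': "continuous_on {0..} h''"
  shows "C2_on UNIV (\<lambda>x::real^'n. h ((norm x)\<^sup>2))"
proof -
  let ?u = "\<lambda>x::real^'n. h ((norm x)\<^sup>2)"
  have norm2: "((\<lambda>x::real^'n. (norm x)\<^sup>2) has_derivative (\<lambda>v. 2 * (x \<bullet> v))) (at x)" for x
    unfolding power2_norm_eq_inner by (auto intro!: derivative_eq_intros simp: inner_commute)
  have u: "(?u has_derivative (\<lambda>v. ((2 * h' ((norm x)\<^sup>2)) *\<^sub>R x) \<bullet> v)) (at x)" for x
  proof -
    have "(h has_derivative (*) (h' ((norm x)\<^sup>2))) (at ((norm x)\<^sup>2))"
      using h[of "(norm x)\<^sup>2"] by (simp add: has_field_derivative_def)
    from has_derivative_compose[OF norm2 this] show ?thesis by (simp add: mult_ac)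
  qed
  have grad: "gradient ?u = (\<lambda>x. (2 * h' ((norm x)\<^sup>2)) *\<^sub>R x)"
    by (rule ext) (rule gradient_eqI[OF u])
  have g: "(gradient ?u has_derivative
      (\<lambda>v. (2 * h' ((norm x)\<^sup>2)) *\<^sub>R v + (4 * h'' ((norm x)\<^sup>2) * (x \<bullet> v)) *\<^sub>R x)) (at x)" for x
  proof -
    have "(h' has_derivative (*) (h'' ((norm x)\<^sup>2))) (at ((norm x)\<^sup>2))"
      using h'[of "(norm x)\<^sup>2"] by (simp add: has_field_derivative_def)
    from has_derivative_compose[OF norm2 this]
    have "((\<lambda>x. h' ((norm x)\<^sup>2)) has_derivative (\<lambda>v. h'' ((norm x)\<^sup>2) * (2 * (x \<bullet> v)))) (at x)" .
    then show ?thesis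
      unfolding grad by (auto intro!: derivative_eq_intros simp: algebra_simps)
  qed
  have hess: "hessian ?u = (\<lambda>x. \<chi> i j. 2 * h' ((norm x)\<^sup>2) * axis j 1 $ i + 4 * h'' ((norm x)\<^sup>2) * x $ j * x $ i)"
    unfolding hessian_def jacobian_def frechet_derivative_at[OF g, symmetric]
    by (simp add: fun_eq_iff matrix_def inner_axis)
  have "continuous_on {0..} h'"
    by (intro continuous_at_imp_continuous_on ballI) (metis h' DERIV_isCont atLeast_iff)
  then have "continuous_on UNIV (\<lambda>x::real^'n. h' ((norm x)\<^sup>2))"
    by (rule continuous_on_compose2) (auto intro!: continuous_intros)
  moreover have "continuous_on UNIV (\<lambda>x::real^'n. h'' ((norm x)\<^sup>2))"
    by (rule continuous_on_compose2[OF h'']) (auto intro!: continuous_intros)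
  ultimately have "continuous_on UNIV (hessian ?u)"
    unfolding hess by (auto intro!: continuous_intros)
  then show ?thesis
    using u g unfolding C2_on_def differentiable_def by blast
qed

text \<open>The tangent inequality says that \<open>h\<close> is convex with slope \<open>- h\<^sup>p / (2 k)\<close>.

  If a test function touches from above at \<open>x\<close>, the tangent line of \<open>h\<close> at \<open>|x|\<^sup>2\<close> gives a paraboloid
  below it, with all Hessian eigenvalues equal to \<open>- h\<^sup>p / k\<close>. If a test function touches from below,
  then moving orthogonally to \<open>x\<close> increases \<open>|x|\<^sup>2\<close> only to second order, and the tangent inequality at
  the displaced point gives, up to an arbitrarily small error, the same paraboloid above it in \<open>N - 1\<close>
  directions. Since \<open>h\<close> need not be twice differentiable, solutions with a free boundary are included.\<close>

lemma radial_viscosity_solution: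
  fixes h :: "real \<Rightarrow> real"
  assumes k: "1 \<le> k" "k < CARD('n)" and p: "0 < p"
    and cont: "continuous_on {0..} h" and nonneg: "\<And>s. 0 \<le> s \<Longrightarrow> 0 \<le> h s"
    and tangent: "\<And>s s'. 0 \<le> s \<Longrightarrow> 0 \<le> s' \<Longrightarrow> h s' \<ge> h s - h s powr p / (2 * real k) * (s' - s)"
  shows "viscosity_solution (P_minus k) p UNIV (\<lambda>x::real^'n. h ((norm x)\<^sup>2))"
proof -
  let ?u = "\<lambda>x::real^'n. h ((norm x)\<^sup>2)"
  have cont_u: "continuous_on UNIV ?u"
    by (rule continuous_on_compose2[OF cont]) (auto intro!: continuous_intros)
  then have lim: "(?u \<longlongrightarrow> ?u x) (at x)" for x
    by (simp add: continuous_on_def)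
  have super: "P_minus k (hessian \<phi> x) + ?u x powr p \<le> 0"
    if C2: "C2_on UNIV \<phi>" and min: "local_min_at UNIV (\<lambda>x. ?u x - \<phi> x) x" for \<phi> x
  proof -
    define c where "c = ?u x powr p / (2 * real k)"
    have *: "P_minus k (hessian \<phi> x) \<le> 2 * real k * (\<epsilon> - c)" if \<epsilon>: "0 < \<epsilon>" for \<epsilon>
    proof (rule P_minus_hessian_le[OF C2 k(2)])
      fix v assume v: "x \<bullet> v = 0"
      have "\<forall>\<^sub>F y in nhds x. ?u x - \<phi> x \<le> ?u y - \<phi> y"
        using min by (simp add: local_min_at_def eventually_nhds_conv_at)
      then have 1: "\<forall>\<^sub>F t in at 0. ?u x - \<phi> x \<le> ?u (x + t *\<^sub>R v) - \<phi> (x + t *\<^sub>R v)"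
        using tendsto_along_line by (rule eventually_compose_filterlim)
      have "isCont ?u x"
        using cont_u by (simp add: continuous_on_eq_continuous_at)
      then have "((\<lambda>t. ?u (x + t *\<^sub>R v)) \<longlongrightarrow> ?u x) (at 0)"
        using tendsto_along_line by (rule isCont_tendsto_compose)
      then have "((\<lambda>t. ?u (x + t *\<^sub>R v) powr p / (2 * real k)) \<longlongrightarrow> c) (at 0)"
        unfolding c_def using p k nonneg by (intro tendsto_divide tendsto_powr' tendsto_const) auto
      then have 2: "\<forall>\<^sub>F t in at 0. c - \<epsilon> < ?u (x + t *\<^sub>R v) powr p / (2 * real k)"
        using \<epsilon> by (intro order_tendstoD) auto
      show "\<forall>\<^sub>F t in at 0. \<phi> (x + t *\<^sub>R v) - (\<epsilon> - c) * (norm (x + t *\<^sub>R v))\<^sup>2 \<le> \<phi> x - (\<epsilon> - c) * (norm x)\<^sup>2"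
        using 1 2
      proof eventually_elim
        case (elim t)
        let ?y = "x + t *\<^sub>R v"
        define d where "d = (norm ?y)\<^sup>2 - (norm x)\<^sup>2"
        \<comment> \<open>No linear term appears because \<open>v\<close> is tangential.\<close>
        have "d = t\<^sup>2 * (v \<bullet> v)"
          unfolding d_def power2_norm_eq_inner using v
          by (simp add: inner_add_left inner_add_right inner_commute power2_eq_square)
        then have "0 \<le> d" by simp
        then have "(c - \<epsilon>) * d \<le> ?u ?y powr p / (2 * real k) * d"
          using elim(2) by (intro mult_right_mono) auto
        moreover have "?u x \<ge> ?u ?y - ?u ?y powr p / (2 * real k) * (- d)"
          using tangent[of "(norm ?y)\<^sup>2" "(norm x)\<^sup>2"] by (simp add: d_def)
        ultimately have "?u ?y - ?u x \<le> (\<epsilon> - c) * d"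
          by (simp add: algebra_simps)
        then have "\<phi> ?y - \<phi> x \<le> (\<epsilon> - c) * d" using elim(1) by linarith
        then show ?case by (simp add: d_def right_diff_distrib)
      qed
    qed
    have "P_minus k (hessian \<phi> x) \<le> 2 * real k * (- c) + \<epsilon>" if "0 < \<epsilon>" for \<epsilon>
      using *[of "\<epsilon> / (2 * real k)"] that k(1) by (simp add: right_diff_distrib)
    then have "P_minus k (hessian \<phi> x) \<le> 2 * real k * (- c)"
      by (rule field_le_epsilon)
    then show ?thesis using k(1) by (simp add: c_def)
  qed
  have sub: "P_minus k (hessian \<phi> x) + ?u x powr p \<ge> 0"
    if C2: "C2_on UNIV \<phi>" and max: "local_max_at UNIV (\<lambda>x. ?u x - \<phi> x) x" for \<phi> x
  proof -
    define c where "c = ?u x powr p / (2 * real k)"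
    have "\<forall>\<^sub>F y in nhds x. ?u y - \<phi> y \<le> ?u x - \<phi> x"
      using max by (simp add: local_max_at_def eventually_nhds_conv_at)
    then have "\<forall>\<^sub>F y in nhds x. \<phi> y - (- c) * (norm y)\<^sup>2 \<ge> \<phi> x - (- c) * (norm x)\<^sup>2"
    proof eventually_elim
      case (elim y)
      have "?u y \<ge> ?u x - c * ((norm y)\<^sup>2 - (norm x)\<^sup>2)"
        using tangent[of "(norm x)\<^sup>2" "(norm y)\<^sup>2"] by (simp add: c_def)
      with elim show ?case by (simp add: right_diff_distrib)
    qed
    from P_minus_hessian_ge[OF C2 k(2) this] show ?thesis
      using k(1) by (simp add: c_def)
  qed
  have "lower_semicontinuous_on UNIV ?u" "upper_semicontinuous_on UNIV ?u"
    unfolding lower_semicontinuous_on_def upper_semicontinuous_on_def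
    using order_tendstoD[OF lim] by auto
  then show ?thesis
    unfolding viscosity_solution_def viscosity_supersolution_def viscosity_subsolution_def
    using cont_u nonneg super sub by auto
qed

lemma tangent_below_if_mono_derivative:
  fixes f f' :: "real \<Rightarrow> real"
  assumes f: "\<And>s. 0 \<le> s \<Longrightarrow> (f has_real_derivative f' s) (at s)"
    and mono: "\<And>s t. 0 \<le> s \<Longrightarrow> s \<le> t \<Longrightarrow> f' s \<le> f' t" and st: "0 \<le> s" "0 \<le> t"
  shows "f t \<ge> f s + f' s * (t - s)"
proof (cases s t rule: linorder_cases)
  case less
  obtain z where z: "s < z" "z < t" "f t - f s = (t - s) * f' z"
    using MVT2[OF less, of f f'] f st by auto
  have "(t - s) * f' s \<le> (t - s) * f' z"
    using z st mono by (intro mult_left_mono) auto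
  with z(3) show ?thesis by (simp add: algebra_simps)
next
  case greater
  obtain z where z: "t < z" "z < s" "f s - f t = (s - t) * f' z"
    using MVT2[OF greater, of f f'] f st by auto
  have "(s - t) * f' z \<le> (s - t) * f' s"
    using z st mono by (intro mult_left_mono) auto
  with z show ?thesis by (simp add: algebra_simps)
qed simp

text \<open>A function of class \<open>C\<^sup>2\<close> is its own test function, from both sides.\<close>

lemma classical_solution_if_C2_viscosity:
  assumes "viscosity_solution F p UNIV u" and "C2_on UNIV u"
  shows "classical_solution F p UNIV u"
proof -
  have "F (hessian u x) + u x powr p \<le> 0" "F (hessian u x) + u x powr p \<ge> 0" for x
    using assms unfolding viscosity_solution_def viscosity_supersolution_def viscosity_subsolution_def
      local_min_at_def local_max_at_def by force+
  then show ?thesis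
    using assms unfolding classical_solution_def viscosity_solution_def viscosity_supersolution_def
    by (simp add: antisym)
qed

text \<open>A positive solution of the differential equation \<open>2 k h' = - h\<^sup>p\<close> decreases, so its derivative increases
  and \<open>h\<close> is convex; being positive, it also inherits a second derivative from the equation. The
  derivatives are two-sided even at \<open>0\<close>, as differentiability of \<open>h (|x|\<^sup>2)\<close> at the origin is derived from
  the chain rule.\<close>

lemma radial_solution_from_ode:
  fixes h :: "real \<Rightarrow> real"
  assumes k: "1 \<le> k" "k < CARD('n)" and p: "0 < p"
    and pos: "\<And>s. 0 \<le> s \<Longrightarrow> 0 < h s"
    and ode: "\<And>s. 0 \<le> s \<Longrightarrow> (h has_real_derivative - (h s powr p) / (2 * real k)) (at s)"
  shows "viscosity_solution (P_minus k) p UNIV (\<lambda>x::real^'n. h ((norm x)\<^sup>2))"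
    and "classical_solution (P_minus k) p UNIV (\<lambda>x::real^'n. h ((norm x)\<^sup>2))"
proof -
  have cont: "continuous_on {0..} h"
    by (intro continuous_at_imp_continuous_on ballI) (metis ode DERIV_isCont atLeast_iff)
  have decr: "h t \<le> h s" if "0 \<le> s" "s \<le> t" for s t
    using that(2)
  proof (rule DERIV_nonpos_imp_nonincreasing)
    fix x assume "s \<le> x" "x \<le> t"
    then show "\<exists>y. (h has_real_derivative y) (at x) \<and> y \<le> 0"
      using that ode by (intro exI[of _ "- (h x powr p) / (2 * real k)"]) auto
  qed
  have "h t \<ge> h s + - (h s powr p) / (2 * real k) * (t - s)" if "0 \<le> s" "0 \<le> t" for s t
  proof (rule tangent_below_if_mono_derivative[OF ode _ that])
    fix s t :: real assume "0 \<le> s" "s \<le> t"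
    then have "h t powr p \<le> h s powr p"
      using decr[of s t] pos[of t] p by (intro powr_mono2) auto
    then show "- (h s powr p) / (2 * real k) \<le> - (h t powr p) / (2 * real k)"
      by (simp add: divide_right_mono)
  qed
  then show visc: "viscosity_solution (P_minus k) p UNIV (\<lambda>x::real^'n. h ((norm x)\<^sup>2))"
    using k p cont pos by (intro radial_viscosity_solution) (auto intro: less_imp_le)
  let ?h' = "\<lambda>s. - (h s powr p) / (2 * real k)"
  let ?h'' = "\<lambda>s. - (p * h s powr (p - 1) * ?h' s) / (2 * real k)"
  have "C2_on UNIV (\<lambda>x::real^'n. h ((norm x)\<^sup>2))"
  proof (rule C2_radial[of h ?h' ?h''])
    fix s :: real assume s: "0 \<le> s"
    show "(h has_real_derivative ?h' s) (at s)" by (rule ode[OF s])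
    have "((\<lambda>s. h s powr p) has_real_derivative p * h s powr (p - 1) * ?h' s) (at s)"
      using DERIV_fun_powr[OF ode[OF s] pos[OF s], of p] by simp
    then show "(?h' has_real_derivative ?h'' s) (at s)"
      by (intro DERIV_cdivide DERIV_minus)
  next
    show "continuous_on {0..} ?h''"
      using pos k by (intro continuous_intros cont) (auto simp: less_imp_neq[symmetric])
  qed
  with visc show "classical_solution (P_minus k) p UNIV (\<lambda>x::real^'n. h ((norm x)\<^sup>2))"
    by (rule classical_solution_if_C2_viscosity)
qed

text \<open>For \<open>p \<ge> 1\<close> the differential equation with \<open>h 0 = 1\<close> has a positive solution on the whole half-line:
  an exponential for \<open>p = 1\<close>, and a negative power of an affine function for \<open>p > 1\<close>.\<close>

lemma positive_solution_exists:
  assumes k: "1 \<le> k" "k < CARD('n)" and p: "1 \<le> p"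
  obtains u :: "real^'n \<Rightarrow> real" where "viscosity_solution (P_minus k) p UNIV u"
    and "classical_solution (P_minus k) p UNIV u" and "\<And>x. 0 < u x"
proof (cases "p = 1")
  case True
  let ?h = "\<lambda>s. exp (- s / (2 * real k))"
  have "(?h has_real_derivative - (?h s powr p) / (2 * real k)) (at s)" for s
    unfolding True using k(1) by (auto intro!: derivative_eq_intros)
  from radial_solution_from_ode[OF k _ _ this] show ?thesis
    using that[of "\<lambda>x. ?h ((norm x)\<^sup>2)"] p by simp
next
  case False
  define q where "q = 1 / (1 - p)"
  let ?y = "\<lambda>s. 1 + (p - 1) * s / (2 * real k)"
  have y: "0 < ?y s" if "0 \<le> s" for s
    using that p by (intro add_pos_nonneg) auto
  have "((\<lambda>s. ?y s powr q) has_real_derivative - ((?y s powr q) powr p) / (2 * real k)) (at s)" if s: "0 \<le> s" for s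
  proof -
    have "(?y has_real_derivative (p - 1) / (2 * real k)) (at s)"
      using k(1) by (auto intro!: derivative_eq_intros simp: field_simps)
    from DERIV_fun_powr[OF this y[OF s], of q]
    have "((\<lambda>s. ?y s powr q) has_real_derivative q * ?y s powr (q - 1) * ((p - 1) / (2 * real k))) (at s)"
      by simp
    moreover have q: "q * (p - 1) = -1" "q * p = q - 1"
      using False by (auto simp: q_def field_simps)
    have "q * ?y s powr (q - 1) * ((p - 1) / (2 * real k)) = q * (p - 1) * ?y s powr (q - 1) / (2 * real k)"
      by simp
    then have "q * ?y s powr (q - 1) * ((p - 1) / (2 * real k)) = - ((?y s powr q) powr p) / (2 * real k)"
      unfolding powr_powr q by simp
    ultimately show ?thesis by simp
  qed
  from radial_solution_from_ode[OF k _ _ this] show ?thesis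
    using that[of "\<lambda>x. ?y ((norm x)\<^sup>2) powr q"] p y by (simp add: less_imp_neq[symmetric])
qed

text \<open>For \<open>p < 1\<close> the solution of the same differential equation reaches zero at a finite point and is continued
  by zero. It is a power \<open>q > 1\<close> of the positive part of an affine function, hence still convex,
  and \<open>q p = q - 1\<close> turns its slope into \<open>- h\<^sup>p / (2 k)\<close>, also where it vanishes.\<close>

lemma compactly_supported_solution:
  assumes k: "1 \<le> k" "k < CARD('n)" and p: "0 < p" "p < 1"
  obtains u :: "real^'n \<Rightarrow> real" where "viscosity_solution (P_minus k) p UNIV u" and "u 0 = 1"
proof -
  define q where "q = 1 / (1 - p)"
  have q: "1 \<le> q" "q * (1 - p) = 1" "q * p = q - 1"
    using p by (auto simp: q_def field_simps)
  let ?y = "\<lambda>s. 1 - (1 - p) * s / (2 * real k)"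
  let ?h = "\<lambda>s. max 0 (?y s) powr q"
  have tangent: "max 0 z powr q \<ge> max 0 y powr q + q * max 0 y powr (q - 1) * (z - y)" for y z :: real
  proof (cases "0 < y")
    case y: True
    show ?thesis
    proof (cases "0 < z")
      case True
      have "((\<lambda>x. x powr q) has_real_derivative q * y powr (q - 1)) (at y within {0<..})"
        using y by (auto intro!: derivative_eq_intros)
      then have "z powr q - y powr q \<ge> q * y powr (q - 1) * (z - y)"
        using y True q(1)
        by (intro convex_on_imp_above_tangent[OF powr_convex]) (auto simp: interior_open)
      then show ?thesis using y True by simp
    next
      case False
      \<comment> \<open>As \<open>q \<ge> 1\<close>, the tangent at \<open>y\<close> is already nonpositive at \<open>0\<close>.\<close>
      have "y powr q = y powr (q - 1) * y"
        using y by (simp add: powr_diff)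
      moreover have "y \<le> q * (y - z)"
        using mult_mono[of 1 q y "y - z"] q(1) y False by simp
      then have "y powr (q - 1) * y \<le> y powr (q - 1) * (q * (y - z))"
        by (rule mult_left_mono) simp
      ultimately show ?thesis using y False by (simp add: algebra_simps)
    qed
  qed (simp add: max_def)
  have "viscosity_solution (P_minus k) p UNIV (\<lambda>x::real^'n. ?h ((norm x)\<^sup>2))"
  proof (rule radial_viscosity_solution[OF k p(1)])
    show "continuous_on {0..} ?h"
      using q(1) k(1) by (intro continuous_on_powr' continuous_intros) auto
    show "?h t \<ge> ?h s - ?h s powr p / (2 * real k) * (t - s)" for s t
    proof -
      have "q * (?y t - ?y s) = - (q * (1 - p)) / (2 * real k) * (t - s)"
        using k(1) by (simp add: field_simps)
      also have "\<dots> = - (t - s) / (2 * real k)" by (simp add: q(2) diff_divide_distrib)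
      finally have qy: "q * (?y t - ?y s) = - (t - s) / (2 * real k)" .
      have eq: "a * (- (t - s) / K) = - (a / K * (t - s))" for a K :: real
        by (simp add: right_diff_distrib diff_divide_distrib)
      have "q * max 0 (?y s) powr (q - 1) * (?y t - ?y s) = max 0 (?y s) powr (q - 1) * (q * (?y t - ?y s))"
        by (simp only: mult_ac)
      then have "q * max 0 (?y s) powr (q - 1) * (?y t - ?y s) = - (?h s powr p / (2 * real k) * (t - s))"
        unfolding qy powr_powr q(3) eq .
      then show ?thesis using tangent[of "?y s" "?y t"] by linarith
    qed
  qed simp
  then show thesis by (rule that) simp
qed

section \<open>Nonexistence of positive supersolutions\<close>

lemma lower_semicontinuous_on_attains_inf:
  fixes u :: "'a::topological_space \<Rightarrow> real"
  assumes K: "compact K" "K \<noteq> {}" and u: "lower_semicontinuous_on K u"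
  shows "\<exists>x\<in>K. \<forall>y\<in>K. u x \<le> u y"
proof (rule ccontr)
  assume contra: "\<not> (\<exists>x\<in>K. \<forall>y\<in>K. u x \<le> u y)"
  have "\<exists>y T. y \<in> K \<and> open T \<and> x \<in> T \<and> (\<forall>z\<in>T \<inter> K. u y < u z)" if x: "x \<in> K" for x
  proof -
    have "\<not> (\<forall>y\<in>K. u x \<le> u y)" using contra x by blast
    then obtain y where y: "y \<in> K" "u y < u x" by (auto simp: not_le)
    then have "eventually (\<lambda>z. u y < u z) (at x within K)"
      using u x by (auto simp: lower_semicontinuous_on_def)
    then obtain T where "open T" "x \<in> T" "\<forall>z\<in>T. z \<noteq> x \<longrightarrow> z \<in> K \<longrightarrow> u y < u z"
      unfolding eventually_at_topological by blast
    then have "\<forall>z\<in>T \<inter> K. u y < u z" using y(2) by (metis IntE)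
    with y \<open>open T\<close> \<open>x \<in> T\<close> show ?thesis by blast
  qed
  then have "\<forall>x\<in>K. \<exists>y T. y \<in> K \<and> open T \<and> x \<in> T \<and> (\<forall>z\<in>T \<inter> K. u y < u z)"
    by blast
  then obtain Y T where YT: "\<forall>x\<in>K. Y x \<in> K \<and> open (T x) \<and> x \<in> T x \<and> (\<forall>z\<in>T x \<inter> K. u (Y x) < u z)"
    unfolding bchoice_iff by blast
  obtain D where D: "D \<subseteq> K" "finite D" "K \<subseteq> (\<Union>x\<in>D. T x)"
    using compactE_image[OF K(1), of K T] YT by blast
  have "D \<noteq> {}" using D(3) K(2) by auto
  obtain x where x: "x \<in> D" "\<And>x'. x' \<in> D \<Longrightarrow> u (Y x) \<le> u (Y x')"
    using arg_min_if_finite[OF D(2) \<open>D \<noteq> {}\<close>, of "\<lambda>x. u (Y x)"] by (metis not_le)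
  have "Y x \<in> K" using YT D(1) x(1) by blast
  then obtain x' where "x' \<in> D" "Y x \<in> T x'" using D(3) by blast
  then have "u (Y x') < u (Y x)" using YT D(1) \<open>Y x \<in> K\<close> by blast
  with x(2)[OF \<open>x' \<in> D\<close>] show False by simp
qed

lemma lower_semicontinuous_on_divide:
  fixes u w :: "'a::t2_space \<Rightarrow> real"
  assumes u: "lower_semicontinuous_on K u" and w: "continuous_on K w" "\<And>x. x \<in> K \<Longrightarrow> 0 < w x"
  shows "lower_semicontinuous_on K (\<lambda>x. u x / w x)"
  unfolding lower_semicontinuous_on_def
proof (intro ballI allI impI)
  fix x a assume x: "x \<in> K" and a: "a < u x / w x"
  then have "a * w x < u x" using w(2)[OF x] by (simp add: field_simps)
  then obtain b where b: "a * w x < b" "b < u x" using dense by blast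
  have "((\<lambda>y. a * w y) \<longlongrightarrow> a * w x) (at x within K)"
    using w(1) x by (intro tendsto_intros) (simp add: continuous_on_def)
  then have "eventually (\<lambda>y. a * w y < b) (at x within K)"
    using b(1) by (rule order_tendstoD)
  moreover have "eventually (\<lambda>y. b < u y) (at x within K)"
    using u x b(2) by (simp add: lower_semicontinuous_on_def)
  moreover have "eventually (\<lambda>y. y \<in> K) (at x within K)"
    by (simp add: eventually_at_filter)
  ultimately show "eventually (\<lambda>y. a < u y / w y) (at x within K)"
    by eventually_elim (use w(2) in \<open>simp add: field_simps\<close>)
qed

text \<open>Take for \<open>B\<close> the infimum over the open ball of the quotient of \<open>u\<close> by \<open>(\<rho> - |x|\<^sup>2)\<^sup>m\<close>. As \<open>u\<close> is
  bounded below by a positive constant on the closed ball, the quotient blows up at the boundary, so the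
  infimum is positive and attained inside.\<close>

lemma ball_bump_touches_from_below:
  fixes u :: "real^'n \<Rightarrow> real"
  assumes lsc: "lower_semicontinuous_on UNIV u" and pos: "\<And>x. 0 < u x"
    and \<rho>: "0 < \<rho>" and m: "1 \<le> m"
  obtains B x where "0 < B" "B * \<rho> ^ m \<le> u 0" "(norm x)\<^sup>2 < \<rho>" "u x = B * (\<rho> - (norm x)\<^sup>2) ^ m"
    "\<And>y. (norm y)\<^sup>2 < \<rho> \<Longrightarrow> B * (\<rho> - (norm y)\<^sup>2) ^ m \<le> u y"
proof -
  let ?w = "\<lambda>x::real^'n. (\<rho> - (norm x)\<^sup>2) ^ m"
  have sub: "lower_semicontinuous_on K u" for K
    using lsc by (auto simp: lower_semicontinuous_on_def intro: filter_leD[OF at_le])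
  have comp: "compact {x::real^'n. (norm x)\<^sup>2 \<le> r}" for r
  proof -
    have "(norm x)\<^sup>2 \<le> r \<longleftrightarrow> norm x \<le> sqrt r" for x :: "real^'n"
    proof -
      have root: "sqrt ((norm x)\<^sup>2) = norm x" by simp
      show ?thesis
        using real_sqrt_le_iff[of "(norm x)\<^sup>2" r] unfolding root by (rule sym)
    qed
    then have "{x::real^'n. (norm x)\<^sup>2 \<le> r} = {x. norm x \<le> sqrt r}"
      by (simp only:)
    also have "\<dots> = cball 0 (sqrt r)"
      by auto
    finally show ?thesis by (simp only: compact_cball)
  qed
  have "0 \<in> {x::real^'n. (norm x)\<^sup>2 \<le> \<rho>}"
    using \<rho> by simp
  then have "{x::real^'n. (norm x)\<^sup>2 \<le> \<rho>} \<noteq> {}"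
    by blast
  then obtain z where z: "\<forall>y\<in>{x::real^'n. (norm x)\<^sup>2 \<le> \<rho>}. u z \<le> u y"
    using lower_semicontinuous_on_attains_inf[OF comp _ sub] by blast
  define \<mu> where "\<mu> = u z"
  have \<mu>: "0 < \<mu>" "\<And>y. (norm y)\<^sup>2 \<le> \<rho> \<Longrightarrow> \<mu> \<le> u y"
    using pos z by (simp_all add: \<mu>_def)
  have \<mu>0: "\<mu> \<le> u 0" using \<mu>(2)[of 0] \<rho> by simp
  \<comment> \<open>The shell where \<open>\<rho> - |y|\<^sup>2 < \<delta>\<close> can be discarded: there the quotient is at least \<open>A\<close>,
    its value at the origin.\<close>
  define \<delta> where "\<delta> = \<rho> * (\<mu> / u 0)"
  define A where "A = u 0 / \<rho> ^ m"
  have \<delta>: "0 < \<delta>" "\<delta> \<le> \<rho>"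
    using \<rho> \<mu>(1) \<mu>0 pos[of 0] mult_left_mono[of "\<mu> / u 0" 1 \<rho>] by (auto simp: \<delta>_def)
  have "A * \<delta> ^ m = u 0 * (\<mu> / u 0) ^ m"
    using \<rho> by (simp add: A_def \<delta>_def power_mult_distrib power_divide)
  also have "\<dots> \<le> u 0 * (\<mu> / u 0)"
    using \<mu>(1) \<mu>0 pos[of 0] m power_decreasing[of 1 m "\<mu> / u 0"] by (intro mult_left_mono) auto
  finally have A: "A * \<delta> ^ m \<le> \<mu>" using pos[of 0] by simp
  define K where "K = {x::real^'n. (norm x)\<^sup>2 \<le> \<rho> - \<delta>}"
  have wpos: "0 < ?w x" if "(norm x)\<^sup>2 < \<rho>" for x using that by simp
  have "lower_semicontinuous_on K (\<lambda>x. u x / ?w x)"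
    using \<delta> by (intro lower_semicontinuous_on_divide sub wpos) (auto simp: K_def intro!: continuous_intros)
  moreover have "compact K" "0 \<in> K" using comp \<delta> by (auto simp: K_def)
  ultimately have "\<exists>x\<in>K. \<forall>y\<in>K. u x / ?w x \<le> u y / ?w y"
    by (intro lower_semicontinuous_on_attains_inf) auto
  then obtain x where x: "x \<in> K" "\<And>y. y \<in> K \<Longrightarrow> u x / ?w x \<le> u y / ?w y"
    by blast
  define B where "B = u x / ?w x"
  have x\<rho>: "(norm x)\<^sup>2 < \<rho>" using x(1) \<delta> by (simp add: K_def)
  have BA: "B \<le> A" using x(2)[OF \<open>0 \<in> K\<close>] by (simp add: B_def A_def)
  show thesis
  proof (rule that[of B x])
    show "0 < B" using wpos[OF x\<rho>] pos by (simp add: B_def)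
    show "B * \<rho> ^ m \<le> u 0" using BA \<rho> by (simp add: A_def field_simps)
    show "(norm x)\<^sup>2 < \<rho>" by (rule x\<rho>)
    show "u x = B * ?w x" using x\<rho> by (simp add: B_def)
    fix y :: "real^'n" assume y: "(norm y)\<^sup>2 < \<rho>"
    show "B * ?w y \<le> u y"
    proof (cases "y \<in> K")
      case True
      then show ?thesis
        using x(2)[OF True] wpos[OF y] by (simp add: B_def pos_le_divide_eq)
    next
      case False
      then have "?w y \<le> \<delta> ^ m"
        using y by (intro power_mono) (auto simp: K_def)
      moreover have "0 \<le> A" using pos[of 0] \<rho> by (simp add: A_def)
      ultimately have "B * ?w y \<le> A * \<delta> ^ m"
        using BA wpos[OF y] by (intro mult_mono) auto
      also have "\<dots> \<le> u y" using A \<mu>(2)[of y] y by simp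
      finally show ?thesis .
    qed
  qed
qed

text \<open>Let \<open>m (1 - p) \<ge> 1\<close> and touch \<open>u\<close> from below at \<open>x\<close> by \<open>B (\<rho> - |x|\<^sup>2)\<^sup>m\<close>. With \<open>y = \<rho> - |x|\<^sup>2\<close>,
  convexity of the power bounds all Hessian eigenvalues of the bump below by \<open>- 2 B m y\<^sup>m\<^sup>-\<^sup>1\<close>, so the equation
  gives \<open>u(x)\<^sup>p \<le> 2 k m u(x) / y\<close>, that is, \<open>y \<le> 2 k m u(x)\<^sup>1\<^sup>-\<^sup>p\<close>. On the other hand
  \<open>u(x) \<le> u(0) (y / \<rho>)\<^sup>m\<close>, and the choice of \<open>m\<close> turns this into \<open>\<rho> \<le> 2 k m u(0)\<^sup>1\<^sup>-\<^sup>p\<close>, which fails for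
  large \<open>\<rho>\<close>. A natural exponent is used to make the bump a polynomial, hence a test function of class
  \<open>C\<^sup>2\<close> on the whole space.\<close>

lemma no_positive_supersolution:
  fixes u :: "real^'n \<Rightarrow> real"
  assumes k: "1 \<le> k" "k < CARD('n)" and p: "0 < p" "p < 1"
    and super: "viscosity_supersolution (P_minus k) p UNIV u" and pos: "\<And>x. 0 < u x"
  shows False
proof -
  obtain m :: nat where m: "1 / (1 - p) \<le> real m" using real_arch_simple by blast
  have mp: "1 \<le> real m * (1 - p)" using m p by (simp add: field_simps)
  then have m1: "1 \<le> m" by (cases m) auto
  \<comment> \<open>The contact point will force \<open>\<rho> \<le> M\<close>.\<close>
  define M where "M = 2 * real k * real m * u 0 powr (1 - p)"
  define \<rho> where "\<rho> = 1 + M"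
  have "0 \<le> M" by (simp add: M_def)
  then have \<rho>: "0 < \<rho>" "M < \<rho>" by (auto simp: \<rho>_def)
  have lsc: "lower_semicontinuous_on UNIV u"
    using super by (simp add: viscosity_supersolution_def)
  obtain B x where B: "0 < B" "B * \<rho> ^ m \<le> u 0" and x: "(norm x)\<^sup>2 < \<rho>" "u x = B * (\<rho> - (norm x)\<^sup>2) ^ m"
    and below: "\<And>y. (norm y)\<^sup>2 < \<rho> \<Longrightarrow> B * (\<rho> - (norm y)\<^sup>2) ^ m \<le> u y"
    using ball_bump_touches_from_below[OF lsc pos \<rho>(1) m1] by metis
  define \<phi> where "\<phi> = (\<lambda>x::real^'n. B * (\<rho> - (norm x)\<^sup>2) ^ m)"
  have C2: "C2_on UNIV \<phi>"
    unfolding \<phi>_def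
  proof (rule C2_radial[where h = "\<lambda>s. B * (\<rho> - s) ^ m"
        and h' = "\<lambda>s. - (B * real m * (\<rho> - s) ^ (m - 1))"
        and h'' = "\<lambda>s. B * real m * (real (m - 1) * (\<rho> - s) ^ (m - 1 - 1))"])
    show "((\<lambda>s. B * (\<rho> - s) ^ m) has_real_derivative - (B * real m * (\<rho> - s) ^ (m - 1))) (at s)" for s
      by (auto intro!: derivative_eq_intros)
    show "((\<lambda>s. - (B * real m * (\<rho> - s) ^ (m - 1))) has_real_derivative
        B * real m * (real (m - 1) * (\<rho> - s) ^ (m - 1 - 1))) (at s)" for s
      by (auto intro!: derivative_eq_intros)
  qed (intro continuous_intros)
  define y where "y = \<rho> - (norm x)\<^sup>2"
  have y: "0 < y" "y \<le> \<rho>" using x by (auto simp: y_def)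
  define a where "a = - (B * (real m * y ^ (m - 1)))"
  have near: "\<forall>\<^sub>F z in nhds x. (norm z)\<^sup>2 < \<rho>"
    using x(1) by (intro order_tendstoD(2)[where y = "(norm x)\<^sup>2"] tendsto_intros filterlim_ident)
  have "\<forall>\<^sub>F z in nhds x. u x - \<phi> x \<le> u z - \<phi> z"
    using near by eventually_elim (use below x(2) in \<open>simp add: \<phi>_def\<close>)
  then have "local_min_at UNIV (\<lambda>x. u x - \<phi> x) x"
    by (simp add: local_min_at_def eventually_nhds_conv_at)
  then have "P_minus k (hessian \<phi> x) + u x powr p \<le> 0"
    using super C2 by (simp add: viscosity_supersolution_def)
  moreover have "P_minus k (hessian \<phi> x) \<ge> 2 * real k * a"
  proof (rule P_minus_hessian_ge[OF C2 k(2)])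
    show "\<forall>\<^sub>F z in nhds x. \<phi> z - a * (norm z)\<^sup>2 \<ge> \<phi> x - a * (norm x)\<^sup>2"
      using near
    proof eventually_elim
      case (elim z)
      have "(\<rho> - (norm z)\<^sup>2) ^ m \<ge> y ^ m + real m * y ^ (m - 1) * ((\<rho> - (norm z)\<^sup>2) - y)"
        using y(1) elim
        by (intro tangent_below_if_mono_derivative[where f = "\<lambda>s. s ^ m" and f' = "\<lambda>s. real m * s ^ (m - 1)"])
          (auto intro!: derivative_eq_intros mult_left_mono power_mono)
      from mult_left_mono[OF this, of B] B(1) show ?case
        by (simp add: \<phi>_def a_def y_def algebra_simps)
    qed
  qed
  ultimately have main: "u x powr p \<le> 2 * real k * (real m * (B * y ^ (m - 1)))"
    by (simp add: a_def mult_ac)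
  have ux: "u x = y * (B * y ^ (m - 1))"
    using x(2) m1 by (simp add: y_def power_eq_if)
  have "y * u x powr p \<le> 2 * real k * real m * u x"
    using mult_left_mono[OF main, of y] y(1) by (simp add: ux mult_ac)
  also have "\<dots> = (2 * real k * real m * u x powr (1 - p)) * u x powr p"
    using pos[of x] by (simp flip: powr_add)
  finally have "y \<le> 2 * real k * real m * u x powr (1 - p)"
    using pos[of x] by (simp only: mult_le_cancel_right_pos powr_gt_zero)
  also have "\<dots> \<le> 2 * real k * real m * (u 0 powr (1 - p) * (y / \<rho>))"
  proof (rule mult_left_mono)
    have "u x \<le> u 0 * (y / \<rho>) ^ m"
      using mult_right_mono[OF B(2), of "(y / \<rho>) ^ m"] x(2) y(1) \<rho>(1) by (simp add: y_def power_divide)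
    then have "u x powr (1 - p) \<le> (u 0 * (y / \<rho>) ^ m) powr (1 - p)"
      using p pos[of x] by (intro powr_mono2) auto
    also have "\<dots> = u 0 powr (1 - p) * (y / \<rho>) powr (real m * (1 - p))"
      using y \<rho>(1) by (simp add: powr_mult powr_powr flip: powr_realpow)
    also have "\<dots> \<le> u 0 powr (1 - p) * (y / \<rho>) powr 1"
      using y \<rho>(1) mp by (intro mult_left_mono powr_mono') auto
    finally show "u x powr (1 - p) \<le> u 0 powr (1 - p) * (y / \<rho>)"
      using y \<rho>(1) by simp
  qed simp
  also have "\<dots> = M * (y / \<rho>)" by (simp add: M_def)
  finally have "\<rho> \<le> M" using y(1) \<rho>(1) by (simp add: field_simps)
  with \<rho>(2) show False by simp
qed

section \<open>Existence and nonexistence\<close>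

theorem theorem1p2:
  fixes k :: nat
  assumes "1 \<le> k" and "k < CARD('n::finite)"
  shows "(\<forall>p::real. 0 < p \<longrightarrow>
            (\<exists>u :: real^'n \<Rightarrow> real.
               viscosity_solution (P_minus k) p UNIV u \<and> (\<exists>x. u x \<noteq> 0))) \<and>
         (\<forall>p::real. 1 \<le> p \<longrightarrow>
            (\<exists>u :: real^'n \<Rightarrow> real.
               classical_solution (P_minus k) p UNIV u \<and> (\<forall>x. 0 < u x))) \<and>
         (\<forall>p::real. 0 < p \<and> p < 1 \<longrightarrow>
            \<not> (\<exists>u :: real^'n \<Rightarrow> real.
               viscosity_supersolution (P_minus k) p UNIV u \<and> (\<forall>x. 0 < u x)))"
proof (intro conjI allI impI)
  fix p :: real assume p: "0 < p"
  show "\<exists>u :: real^'n \<Rightarrow> real. viscosity_solution (P_minus k) p UNIV u \<and> (\<exists>x. u x \<noteq> 0)"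
  proof (cases "p < 1")
    case True
    obtain u :: "real^'n \<Rightarrow> real" where "viscosity_solution (P_minus k) p UNIV u" "u 0 = 1"
      using compactly_supported_solution[OF assms p True] by metis
    then show ?thesis by (metis zero_neq_one)
  next
    case False
    then have "1 \<le> p" by simp
    then obtain u :: "real^'n \<Rightarrow> real" where "viscosity_solution (P_minus k) p UNIV u" "\<And>x. 0 < u x"
      using positive_solution_exists[OF assms] by metis
    then show ?thesis by (metis less_irrefl)
  qed
next
  fix p :: real assume "1 \<le> p"
  then show "\<exists>u :: real^'n \<Rightarrow> real. classical_solution (P_minus k) p UNIV u \<and> (\<forall>x. 0 < u x)"
    using positive_solution_exists[OF assms] by metis
next
  fix p :: real assume "0 < p \<and> p < 1"
  then show "\<not> (\<exists>u :: real^'n \<Rightarrow> real. viscosity_supersolution (P_minus k) p UNIV u \<and> (\<forall>x. 0 < u x))"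
    using no_positive_supersolution[OF assms] by blast
qed

end
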